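(* The (two-way infinite) periodic trapezium strip frameworks, with alternating unequal heights $a>b>0$, are rigid. In particular the rectangle strip linkage is not stably flexible.
   Context: Strip frameworks in $\mathbb{R}^2$: fix a spacing $\delta>0$. The strip with heights $(h_n)_{n\in\mathbb{Z}}$, $h_n>0$, has base points $b_n=(n\delta,0)$ and top points $t_n=(n\delta,h_n)$, $n\in\mathbb{Z}$, with bars $[b_n,t_n]$ and $[t_n,t_{n+1}]$; the base points are held rigidly relative to each other by a fixed periodic girder of bars in the half-plane $y\le0$ containing them, with finitely many bar lengths, which is a union of an increasing sequence of continuously rigid finite frameworks, attached to the top points only via the bars $[b_n,t_n]$. The trapezium strip has $h_n=a$ for $n$ even and $h_n=b$ for $n$ odd; the rectangle strip has all $h_n$ equal. A base-fixed continuous flex of a framework $(G,p)$ in $\mathbb{R}^2$ is $p(t)=(p_v(t))_v$, $t\in[0,1]$, with $p(0)=p$, each $p_v(t)$ continuous, all edge lengths preserved for all $t$, the two endpoints of some edge constant in $t$, and $p(t)\ne p$ for some $t$. $(G,p)$ is flexible if such a flex exists, and rigid otherwise. An $\epsilon$-perturbation of $(G,p)$ is a framework $(G,p')$ with $|p_v-p'_v|<\epsilon$ for all $v$. A distance-regular framework (edge lengths bounded above and bounded away from $0$) is stably flexible if it is flexible and, for sufficiently small $\epsilon>0$, every $\epsilon$-perturbation of it is flexible. *)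

theory Defs
  imports "HOL-Analysis.Analysis"
begin

section \<open>Bar-joint frameworks in the plane\<close>

text \<open>
  A bar is the two-element set of its joints. Only the values of \<open>pos\<close> on \<open>verts\<close> matter.
\<close>

record 'v framework =
  verts :: "'v set"
  bars :: "'v set set"
  pos :: "'v \<Rightarrow> real ^ 2"

definition is_framework :: "'v framework \<Rightarrow> bool" where
  "is_framework F \<longleftrightarrow>
     (\<forall>e \<in> bars F. \<exists>u v. e = {u, v} \<and> u \<in> verts F \<and> v \<in> verts F \<and> u \<noteq> v \<and> pos F u \<noteq> pos F v)"

definition base_fixed_flex :: "'v framework \<Rightarrow> (real \<Rightarrow> 'v \<Rightarrow> real ^ 2) \<Rightarrow> bool" where
  "base_fixed_flex F q \<longleftrightarrow>
     (\<forall>v \<in> verts F. q 0 v = pos F v) \<and>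
     (\<forall>v \<in> verts F. continuous_on {0..1} (\<lambda>t. q t v)) \<and>
     (\<forall>u v. {u, v} \<in> bars F \<longrightarrow>
        (\<forall>t \<in> {0..1}. dist (q t u) (q t v) = dist (pos F u) (pos F v))) \<and>
     (\<exists>u v. {u, v} \<in> bars F \<and> (\<forall>t \<in> {0..1}. q t u = pos F u \<and> q t v = pos F v)) \<and>
     (\<exists>t \<in> {0..1}. \<exists>v \<in> verts F. q t v \<noteq> pos F v)"

definition flexible :: "'v framework \<Rightarrow> bool" where
  "flexible F \<longleftrightarrow> (\<exists>q. base_fixed_flex F q)"

definition rigid :: "'v framework \<Rightarrow> bool" where
  "rigid F \<longleftrightarrow> \<not> flexible F"

definition perturbation :: "real \<Rightarrow> 'v framework \<Rightarrow> 'v framework \<Rightarrow> bool" where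
  "perturbation \<epsilon> F F' \<longleftrightarrow>
     is_framework F' \<and> verts F' = verts F \<and> bars F' = bars F \<and>
     (\<forall>v \<in> verts F. dist (pos F v) (pos F' v) < \<epsilon>)"

definition distance_regular :: "'v framework \<Rightarrow> bool" where
  "distance_regular F \<longleftrightarrow>
     (\<exists>m M. 0 < m \<and>
        (\<forall>u v. {u, v} \<in> bars F \<longrightarrow> m \<le> dist (pos F u) (pos F v) \<and> dist (pos F u) (pos F v) \<le> M))"

definition stably_flexible :: "'v framework \<Rightarrow> bool" where
  "stably_flexible F \<longleftrightarrow>
     distance_regular F \<and> flexible F \<and>
     (\<exists>\<epsilon>\<^sub>0 > 0. \<forall>\<epsilon>. 0 < \<epsilon> \<and> \<epsilon> < \<epsilon>\<^sub>0 \<longrightarrow> (\<forall>F'. perturbation \<epsilon> F F' \<longrightarrow> flexible F'))"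

section \<open>Girders and strips\<close>

text \<open>
  \<open>\<beta> n\<close> is the joint of the girder placed at the base point \<open>(n\<delta>, 0)\<close>.
\<close>

definition periodic_girder :: "real \<Rightarrow> 'g framework \<Rightarrow> (int \<Rightarrow> 'g) \<Rightarrow> bool" where
  "periodic_girder \<delta> G \<beta> \<longleftrightarrow>
     (\<exists>m::nat. \<exists>\<sigma>. m \<ge> 1 \<and> bij_betw \<sigma> (verts G) (verts G) \<and>
        (\<forall>v \<in> verts G. pos G (\<sigma> v) = pos G v + vector [real m * \<delta>, 0]) \<and>
        (\<forall>u \<in> verts G. \<forall>v \<in> verts G. {\<sigma> u, \<sigma> v} \<in> bars G \<longleftrightarrow> {u, v} \<in> bars G) \<and>
        (\<forall>n. \<sigma> (\<beta> n) = \<beta> (n + int m)))"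

definition finitely_many_bar_lengths :: "'v framework \<Rightarrow> bool" where
  "finitely_many_bar_lengths F \<longleftrightarrow> finite {dist (pos F u) (pos F v) | u v. {u, v} \<in> bars F}"

text \<open>
  The members of the exhausting sequence are subframeworks, not necessarily induced ones.
\<close>

definition union_of_rigid_finite :: "'v framework \<Rightarrow> bool" where
  "union_of_rigid_finite F \<longleftrightarrow>
     (\<exists>(V :: nat \<Rightarrow> 'v set) (B :: nat \<Rightarrow> 'v set set).
        incseq V \<and> incseq B \<and> (\<Union>k. V k) = verts F \<and> (\<Union>k. B k) = bars F \<and>
        (\<forall>k. finite (V k) \<and> is_framework \<lparr>verts = V k, bars = B k, pos = pos F\<rparr> \<and>
             rigid \<lparr>verts = V k, bars = B k, pos = pos F\<rparr>))"

text \<open>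
  A framework without bars has no base-fixed flex and so is rigid for trivial reasons;
  \<open>bars G \<noteq> {}\<close> excludes a girder without bars, which would not hold the base points in place.
\<close>

definition girder :: "real \<Rightarrow> 'g framework \<Rightarrow> (int \<Rightarrow> 'g) \<Rightarrow> bool" where
  "girder \<delta> G \<beta> \<longleftrightarrow>
     is_framework G \<and> bars G \<noteq> {} \<and>
     (\<forall>n. \<beta> n \<in> verts G \<and> pos G (\<beta> n) = vector [real_of_int n * \<delta>, 0]) \<and>
     (\<forall>v \<in> verts G. pos G v $ 2 \<le> 0) \<and>
     periodic_girder \<delta> G \<beta> \<and>
     finitely_many_bar_lengths G \<and>
     union_of_rigid_finite G"

datatype 'g strip_joint = Girder 'g | Top int

definition strip ::
  "real \<Rightarrow> 'g framework \<Rightarrow> (int \<Rightarrow> 'g) \<Rightarrow> (int \<Rightarrow> real) \<Rightarrow> 'g strip_joint framework" where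
  "strip \<delta> G \<beta> h =
     \<lparr>verts = Girder ` verts G \<union> range Top,
      bars = (\<lambda>e. Girder ` e) ` bars G
             \<union> {{Girder (\<beta> n), Top n} | n. True}
             \<union> {{Top n, Top (n + 1)} | n. True},
      pos = (\<lambda>x. case x of Girder g \<Rightarrow> pos G g | Top n \<Rightarrow> vector [real_of_int n * \<delta>, h n])\<rparr>"

definition trapezium_strip ::
  "real \<Rightarrow> 'g framework \<Rightarrow> (int \<Rightarrow> 'g) \<Rightarrow> real \<Rightarrow> real \<Rightarrow> 'g strip_joint framework" where
  "trapezium_strip \<delta> G \<beta> a b = strip \<delta> G \<beta> (\<lambda>n. if even n then a else b)"

definition rectangle_strip ::
  "real \<Rightarrow> 'g framework \<Rightarrow> (int \<Rightarrow> 'g) \<Rightarrow> real \<Rightarrow> 'g strip_joint framework" where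
  "rectangle_strip \<delta> G \<beta> h = strip \<delta> G \<beta> (\<lambda>n. h)"

text \<open>
  Rectangle strips are distance-regular, so the failure of \<open>stably_flexible\<close> is never due to that conjunct.
\<close>

lemma dist_vector_2:
  "dist (vector [x, y] :: real ^ 2) (vector [x', y']) = sqrt ((x - x')\<^sup>2 + (y - y')\<^sup>2)"
  by (simp add: dist_vec_def L2_set_def UNIV_2 dist_real_def)

lemma framework_finite_lengths:
  assumes F: "\<And>e. e \<in> bars F \<Longrightarrow> \<exists>u v. e = {u, v} \<and> u \<in> verts F \<and> v \<in> verts F \<and> u \<noteq> v \<and>
      dist (pos F u) (pos F v) \<in> {x \<in> L. x > 0}"
    and L: "finite L"
  shows "is_framework F" and "distance_regular F"
proof -
  show "is_framework F"
    unfolding is_framework_def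
  proof
    fix e assume "e \<in> bars F"
    from F[OF this] obtain u v where
      "e = {u, v}" "u \<in> verts F" "v \<in> verts F" "u \<noteq> v" "dist (pos F u) (pos F v) > 0"
      by blast
    then show "\<exists>u v. e = {u, v} \<and> u \<in> verts F \<and> v \<in> verts F \<and> u \<noteq> v \<and> pos F u \<noteq> pos F v"
      by (intro exI[of _ u] exI[of _ v]) simp
  qed
  define P where "P = insert 1 {x \<in> L. x > 0}"
  have P: "finite P" "P \<noteq> {}"
    using L by (simp_all add: P_def)
  have mem: "dist (pos F u) (pos F v) \<in> P" if "{u, v} \<in> bars F" for u v
  proof -
    from F[OF that] obtain u' v' where "{u, v} = {u', v'}" "dist (pos F u') (pos F v') \<in> P"
      unfolding P_def by blast
    then show ?thesis
      by (auto simp: doubleton_eq_iff dist_commute)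
  qed
  have "0 < Min P"
    using Min_in[OF P] by (auto simp: P_def)
  moreover have "Min P \<le> x" "x \<le> Max P" if "x \<in> P" for x
    using P(1) that by simp_all
  ultimately show "distance_regular F"
    unfolding distance_regular_def using mem by (intro exI[of _ "Min P"] exI[of _ "Max P"]) simp
qed

lemma rectangle_strip_bar:
  assumes "\<delta> > 0" "girder \<delta> G \<beta>" "h > 0" "e \<in> bars (rectangle_strip \<delta> G \<beta> h)"
  shows "\<exists>u v. e = {u, v} \<and> u \<in> verts (rectangle_strip \<delta> G \<beta> h) \<and>
    v \<in> verts (rectangle_strip \<delta> G \<beta> h) \<and> u \<noteq> v \<and>
    dist (pos (rectangle_strip \<delta> G \<beta> h) u) (pos (rectangle_strip \<delta> G \<beta> h) v)
      \<in> {x \<in> {dist (pos G u) (pos G v) | u v. {u, v} \<in> bars G} \<union> {h, \<delta>}. x > 0}"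
proof -
  from assms(4) have "e \<in> (\<lambda>e. Girder ` e) ` bars G \<or>
      (\<exists>n. e = {Girder (\<beta> n), Top n}) \<or> (\<exists>n. e = {Top n, Top (n + 1)})"
    unfolding rectangle_strip_def strip_def by simp
  then consider e' where "e' \<in> bars G" "e = Girder ` e'"
    | n where "e = {Girder (\<beta> n), Top n}" | n where "e = {Top n, Top (n + 1)}"
    by (elim disjE exE imageE)
  then show ?thesis
  proof cases
    case 1
    then obtain u v where "e' = {u, v}" "u \<in> verts G" "v \<in> verts G" "u \<noteq> v" "pos G u \<noteq> pos G v"
      using assms(2) unfolding girder_def is_framework_def by blast
    with 1 show ?thesis
      by (intro exI[of _ "Girder u"] exI[of _ "Girder v"])
        (auto simp: rectangle_strip_def strip_def)
  next
    case 2
    have "\<beta> n \<in> verts G" "pos G (\<beta> n) = vector [real_of_int n * \<delta>, 0]"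
      using assms(2) unfolding girder_def by blast+
    with 2 assms(3) show ?thesis
      by (intro exI[of _ "Girder (\<beta> n)"] exI[of _ "Top n"])
        (simp add: rectangle_strip_def strip_def dist_vector_2 del: zero_less_dist_iff)
  next
    case 3
    have "real_of_int n * \<delta> - real_of_int (n + 1) * \<delta> = - \<delta>"
      by (simp add: algebra_simps)
    with 3 assms(1) show ?thesis
      by (intro exI[of _ "Top n"] exI[of _ "Top (n + 1)"])
        (simp add: rectangle_strip_def strip_def dist_vector_2 del: zero_less_dist_iff of_int_add)
  qed
qed

lemma rectangle_strip_distance_regular:
  assumes "\<delta> > 0" "girder \<delta> G \<beta>" "h > 0"
  shows "is_framework (rectangle_strip \<delta> G \<beta> h)" "distance_regular (rectangle_strip \<delta> G \<beta> h)"
proof -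
  have "finite ({dist (pos G u) (pos G v) | u v. {u, v} \<in> bars G} \<union> {h, \<delta>})"
    using assms(2) unfolding girder_def finitely_many_bar_lengths_def
    by (intro finite_UnI) (blast, simp)
  note fin = this
  show "is_framework (rectangle_strip \<delta> G \<beta> h)"
    using rectangle_strip_bar[OF assms] fin by (rule framework_finite_lengths(1))
  show "distance_regular (rectangle_strip \<delta> G \<beta> h)"
    using rectangle_strip_bar[OF assms] fin by (rule framework_finite_lengths(2))
qed

end

theory Submission
  imports Defs
begin

text \<open>
  The girder can be taken to stand still: composing a flex with a continuous family of rotations and
  translations pins any chosen bar instead of the given one (\<open>rigid_if_pinned_motions_trivial\<close>),
  and pinning one bar of the girder pins the whole girder, because that bar lies in all large members
  of the exhausting sequence of rigid finite frameworks (\<open>girder_pinned_motion_trivial\<close>).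

  Now write the \<open>n\<close>-th top point at a fixed time as \<open>(n\<delta> + x\<^sub>n, y\<^sub>n)\<close>, so that \<open>(x\<^sub>n, y\<^sub>n)\<close> lies on the
  circle of radius \<open>h\<^sub>n\<close>. The length of the bar \<open>[t\<^sub>n, t\<^sub>n\<^sub>+\<^sub>1]\<close> gives
  \<open>\<delta> (x\<^sub>n - x\<^sub>n\<^sub>+\<^sub>1) = h\<^sub>n h\<^sub>n\<^sub>+\<^sub>1 (1 - cos \<gamma>\<^sub>n)\<close>, where \<open>\<gamma>\<^sub>n\<close> is the angle between the neighbouring arms.
  Hence the horizontal displacement \<open>x\<^sub>n\<close> is nonincreasing along the strip, and being bounded it converges
  at both ends. At an end \<open>\<gamma>\<^sub>n\<close> therefore tends to \<open>0\<close>: neighbouring arms become parallel while their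
  horizontal displacements become equal, which for unequal lengths \<open>a \<noteq> b\<close> is only possible
  if the displacement tends to \<open>0\<close>. A monotone sequence with limit \<open>0\<close> at both ends vanishes, so all arms are
  vertical at all times, and by continuity they point upwards.

  Raising every other top point of a rectangle strip by an arbitrarily small amount gives a
  trapezium strip, so the rectangle strip has rigid \<open>\<epsilon>\<close>-perturbations for every \<open>\<epsilon>\<close>.
\<close>

section \<open>Motions and the choice of the pinned bar\<close>

text \<open>
  The part of \<open>base_fixed_flex\<close> that survives a change of the pinned bar and is inherited by subframeworks.
\<close>

definition motion :: "'v framework \<Rightarrow> (real \<Rightarrow> 'v \<Rightarrow> real ^ 2) \<Rightarrow> bool" where
  "motion F q \<longleftrightarrow>
     (\<forall>v \<in> verts F. q 0 v = pos F v) \<and>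
     (\<forall>v \<in> verts F. continuous_on {0..1} (\<lambda>t. q t v)) \<and>
     (\<forall>u v. {u, v} \<in> bars F \<longrightarrow>
        (\<forall>t \<in> {0..1}. dist (q t u) (q t v) = dist (pos F u) (pos F v)))"

lemma base_fixed_flex_motion:
  "base_fixed_flex F q \<longleftrightarrow> motion F q \<and>
     (\<exists>u v. {u, v} \<in> bars F \<and> (\<forall>t \<in> {0..1}. q t u = pos F u \<and> q t v = pos F v)) \<and>
     (\<exists>t \<in> {0..1}. \<exists>v \<in> verts F. q t v \<noteq> pos F v)"
  unfolding base_fixed_flex_def motion_def by blast

lemma framework_barD:
  assumes "is_framework F" "{u, v} \<in> bars F"
  shows "u \<in> verts F" "v \<in> verts F" "pos F u \<noteq> pos F v"
  using assms unfolding is_framework_def by (fastforce simp: doubleton_eq_iff)+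

definition to_complex :: "real ^ 2 \<Rightarrow> complex" where
  "to_complex x = Complex (x $ 1) (x $ 2)"

definition of_complex :: "complex \<Rightarrow> real ^ 2" where
  "of_complex z = (\<chi> i. if i = 1 then Re z else Im z)"

lemma to_of_complex [simp]: "to_complex (of_complex z) = z"
  by (simp add: to_complex_def of_complex_def)

lemma of_to_complex [simp]: "of_complex (to_complex x) = x"
  by (simp add: to_complex_def of_complex_def vec_eq_iff forall_2)

lemma to_complex_inject [simp]: "to_complex x = to_complex y \<longleftrightarrow> x = y"
  by (metis of_to_complex)

lemma dist_to_complex: "dist x y = cmod (to_complex x - to_complex y)"
  by (simp add: to_complex_def dist_vec_def L2_set_def UNIV_2 dist_real_def cmod_def)

lemma continuous_on_to_complex [continuous_intros]:
  assumes "continuous_on S f"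
  shows "continuous_on S (\<lambda>t. to_complex (f t))"
  unfolding to_complex_def Complex_eq by (intro continuous_intros assms)

lemma continuous_on_of_complex [continuous_intros]:
  assumes "continuous_on S f"
  shows "continuous_on S (\<lambda>t. of_complex (f t))"
  unfolding of_complex_def
proof (rule continuous_on_vec_lambda)
  fix i :: 2
  show "continuous_on S (\<lambda>t. if i = 1 then Re (f t) else Im (f t))"
    by (cases "i = 1") (auto intro!: continuous_intros assms)
qed

text \<open>
  In the complex plane a direct isometry is \<open>z \<mapsto> w z + c\<close> with \<open>cmod w = 1\<close>, and the one that carries a
  given bar from its initial to its current position depends continuously on time, since \<open>w\<close> is the
  quotient of the two bar vectors. Undoing it turns a motion into one that pins the bar.
\<close>

lemma motion_pin_bar:
  assumes F: "is_framework F" and q: "motion F q" and bar: "{u0, v0} \<in> bars F"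
  obtains r w c where "motion F r"
    and "\<And>t. t \<in> {0..1} \<Longrightarrow> r t u0 = pos F u0 \<and> r t v0 = pos F v0"
    and "\<And>t v. t \<in> {0..1} \<Longrightarrow> to_complex (q t v) = w t * to_complex (r t v) + c t"
proof -
  note uv = framework_barD[OF F bar]
  define z where "z t v = to_complex (q t v)" for t v
  define d where "d = to_complex (pos F v0) - to_complex (pos F u0)"
  define w where "w t = (z t v0 - z t u0) / d" for t
  define s where "s t v = to_complex (pos F u0) + (z t v - z t u0) / w t" for t v
  have d: "d \<noteq> 0"
    using uv(3) by (simp add: d_def)
  have z0: "z 0 v = to_complex (pos F v)" if "v \<in> verts F" for v
    using q that by (simp add: z_def motion_def)
  have zc: "continuous_on {0..1} (\<lambda>t. z t v)" if "v \<in> verts F" for v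
    unfolding z_def using q that by (intro continuous_intros) (simp add: motion_def)
  have zd: "cmod (z t u - z t v) = cmod (to_complex (pos F u) - to_complex (pos F v))"
    if "{u, v} \<in> bars F" "t \<in> {0..1}" for u v t
    using q that unfolding z_def motion_def dist_to_complex by blast
  have w1: "cmod (w t) = 1" if "t \<in> {0..1}" for t
    using zd[OF bar that] d by (simp add: w_def d_def norm_divide norm_minus_commute)
  then have w0: "w t \<noteq> 0" if "t \<in> {0..1}" for t
    using that by force
  have "motion F (\<lambda>t v. of_complex (s t v))"
    unfolding motion_def
  proof (intro conjI ballI allI impI)
    fix v assume v: "v \<in> verts F"
    have "w 0 = 1"
      using d z0 uv(1,2) by (simp add: w_def d_def)
    then show "of_complex (s 0 v) = pos F v"
      using z0[OF v] z0[OF uv(1)] by (simp add: s_def)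
    show "continuous_on {0..1} (\<lambda>t. of_complex (s t v))"
      unfolding s_def w_def
      by (intro continuous_intros zc v uv d) (use w0 d in \<open>auto simp: w_def\<close>)
  next
    fix u v t assume uv': "{u, v} \<in> bars F" and t: "t \<in> {0..1::real}"
    have "s t u - s t v = (z t u - z t v) / w t"
      by (simp add: s_def diff_divide_distrib)
    then show "dist (of_complex (s t u)) (of_complex (s t v)) = dist (pos F u) (pos F v)"
      using zd[OF uv' t] w1[OF t] by (simp add: dist_to_complex norm_divide)
  qed
  moreover have "of_complex (s t u0) = pos F u0 \<and> of_complex (s t v0) = pos F v0"
    if "t \<in> {0..1}" for t
  proof -
    have "(z t v0 - z t u0) / w t = d"
      using w0[OF that] d by (simp add: w_def)
    then show ?thesis
      by (simp add: s_def d_def)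
  qed
  moreover have "to_complex (q t v) =
      w t * to_complex (of_complex (s t v)) + (z t u0 - w t * to_complex (pos F u0))"
    if "t \<in> {0..1}" for t v
    using w0[OF that] by (simp add: s_def z_def distrib_left)
  ultimately show thesis
    by (rule that)
qed

text \<open>
  A flex that pins some other bar differs from a motion that pins \<open>{u0, v0}\<close> by direct isometries;
  if the latter motion is constant, these isometries fix the two distinct end points of the
  other bar and are therefore the identity.
\<close>

lemma rigid_if_pinned_motions_trivial:
  assumes F: "is_framework F" and bar: "{u0, v0} \<in> bars F"
    and triv: "\<And>r t v. motion F r \<Longrightarrow>
      (\<And>t. t \<in> {0..1} \<Longrightarrow> r t u0 = pos F u0 \<and> r t v0 = pos F v0) \<Longrightarrow>
      t \<in> {0..1} \<Longrightarrow> v \<in> verts F \<Longrightarrow> r t v = pos F v"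
  shows "rigid F"
  unfolding rigid_def flexible_def
proof
  assume "\<exists>q. base_fixed_flex F q"
  then obtain q u v t x where q: "motion F q" and uv: "{u, v} \<in> bars F"
    and fixed: "\<And>t. t \<in> {0..1} \<Longrightarrow> q t u = pos F u \<and> q t v = pos F v"
    and t: "t \<in> {0..1}" and x: "x \<in> verts F" "q t x \<noteq> pos F x"
    unfolding base_fixed_flex_motion by blast
  obtain r w c where r: "motion F r"
    and pin: "\<And>t. t \<in> {0..1} \<Longrightarrow> r t u0 = pos F u0 \<and> r t v0 = pos F v0"
    and iso: "\<And>t v. t \<in> {0..1} \<Longrightarrow> to_complex (q t v) = w t * to_complex (r t v) + c t"
    using motion_pin_bar[OF F q bar] by blast
  have iso': "to_complex (q t y) = w t * to_complex (pos F y) + c t" if "y \<in> verts F" for y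
    using iso[OF t] triv[OF r pin t that] by simp
  note uv' = framework_barD[OF F uv]
  have u: "to_complex (pos F u) = w t * to_complex (pos F u) + c t"
    and v: "to_complex (pos F v) = w t * to_complex (pos F v) + c t"
    using iso'[OF uv'(1)] iso'[OF uv'(2)] fixed[OF t] by simp_all
  have "(w t - 1) * (to_complex (pos F u) - to_complex (pos F v)) =
      (w t * to_complex (pos F u) + c t) - to_complex (pos F u) -
      ((w t * to_complex (pos F v) + c t) - to_complex (pos F v))"
    by (simp add: algebra_simps)
  also have "\<dots> = 0"
    by (simp add: u[symmetric] v[symmetric])
  finally have w: "w t = 1"
    using uv'(3) by simp
  with u have "c t = 0"
    by simp
  with w iso'[OF x(1)] x(2) show False
    by simp
qed

lemma girder_pinned_motion_trivial:
  assumes G: "union_of_rigid_finite G" and r: "motion G r" and bar: "{u0, v0} \<in> bars G"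
    and pin: "\<And>t. t \<in> {0..1} \<Longrightarrow> r t u0 = pos G u0 \<and> r t v0 = pos G v0"
    and t: "t \<in> {0..1}" and v: "v \<in> verts G"
  shows "r t v = pos G v"
proof -
  obtain V B where VB: "incseq V" "incseq B" "(\<Union>k. V k) = verts G" "(\<Union>k. B k) = bars G"
    and rig: "\<And>k::nat. rigid \<lparr>verts = V k, bars = B k, pos = pos G\<rparr>"
    using G unfolding union_of_rigid_finite_def by (elim exE conjE) (simp add: that)
  obtain i j where "v \<in> V i" "{u0, v0} \<in> B j"
    using VB(3,4) v bar by blast
  then have k: "v \<in> V (max i j)" "{u0, v0} \<in> B (max i j)"
    using incseqD[OF VB(1), of i "max i j"] incseqD[OF VB(2), of j "max i j"] by auto
  let ?F = "\<lparr>verts = V (max i j), bars = B (max i j), pos = pos G\<rparr>"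
  have "V (max i j) \<subseteq> verts G" "B (max i j) \<subseteq> bars G"
    using VB(3,4) by blast+
  then have "motion ?F r"
    using r unfolding motion_def by (simp add: subset_iff)
  moreover have "\<not> base_fixed_flex ?F r"
    using rig[of "max i j"] unfolding rigid_def flexible_def by blast
  moreover have "\<exists>u v. {u, v} \<in> bars ?F \<and> (\<forall>t \<in> {0..1}. r t u = pos ?F u \<and> r t v = pos ?F v)"
    using k(2) pin by (intro exI[of _ u0] exI[of _ v0]) simp
  ultimately show ?thesis
    unfolding base_fixed_flex_motion using k(1) t by auto
qed

section \<open>Horizontal displacements along a trapezium strip\<close>

text \<open>
  By Cauchy--Schwarz \<open>x x' + y y' \<le> h h'\<close>, and the length of the top bar says that
  the defect is \<open>\<delta> (x - x')\<close>.
\<close>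

lemma top_bar_displacement:
  fixes x y x' y' h h' \<delta> :: real
  assumes "\<delta> > 0" "h > 0" "h' > 0" "x\<^sup>2 + y\<^sup>2 = h\<^sup>2" "x'\<^sup>2 + y'\<^sup>2 = h'\<^sup>2"
    and "(\<delta> + x' - x)\<^sup>2 + (y' - y)\<^sup>2 = \<delta>\<^sup>2 + (h' - h)\<^sup>2"
  shows "y * y' = h * h' - x * x' - \<delta> * (x - x')" and "x' \<le> x"
proof -
  have "2 * (y * y') = 2 * (h * h' - x * x' - \<delta> * (x - x'))"
    using assms(4-6) by (simp add: power2_eq_square algebra_simps)
  then show eq: "y * y' = h * h' - x * x' - \<delta> * (x - x')"
    by simp
  have "(h * h')\<^sup>2 = (x\<^sup>2 + y\<^sup>2) * (x'\<^sup>2 + y'\<^sup>2)"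
    using assms(4,5) by (simp add: power_mult_distrib)
  also have "\<dots> = (x * x' + y * y')\<^sup>2 + (x * y' - y * x')\<^sup>2"
    by (simp add: power2_eq_square algebra_simps)
  finally have "(x * x' + y * y')\<^sup>2 \<le> (h * h')\<^sup>2"
    by simp
  then have "x * x' + y * y' \<le> h * h'"
    by (rule power2_le_imp_le) (use assms(2,3) in simp)
  then have "0 \<le> \<delta> * (x - x')"
    using eq by simp
  with assms(1) show "x' \<le> x"
    by (simp add: zero_le_mult_iff)
qed

text \<open>
  The displacements decrease to a limit \<open>X\<close>. Passing to the limit in
  \<open>(y y')\<^sup>2 = (h\<^sup>2 - x\<^sup>2) (h'\<^sup>2 - x'\<^sup>2)\<close> with \<open>y y' \<longlonglongrightarrow> a b - X\<^sup>2\<close> gives \<open>2 a b X\<^sup>2 = (a\<^sup>2 + b\<^sup>2) X\<^sup>2\<close>, that is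
  \<open>(a - b)\<^sup>2 X\<^sup>2 = 0\<close>.
\<close>

lemma half_strip_displacement_nonneg:
  fixes x y h :: "nat \<Rightarrow> real"
  assumes \<delta>: "\<delta> > 0" and ab: "a > 0" "b > 0" "a \<noteq> b" and h: "\<And>k. {h k, h (Suc k)} = {a, b}"
    and arm: "\<And>k. (x k)\<^sup>2 + (y k)\<^sup>2 = (h k)\<^sup>2"
    and top: "\<And>k. (\<delta> + x (Suc k) - x k)\<^sup>2 + (y (Suc k) - y k)\<^sup>2 = \<delta>\<^sup>2 + (h (Suc k) - h k)\<^sup>2"
  shows "x 0 \<ge> 0"
proof -
  have hpos: "h k > 0" for k
    using h[of k] ab by (auto simp: doubleton_eq_iff)
  have prod: "h k * h (Suc k) = a * b" and sum: "(h k)\<^sup>2 + (h (Suc k))\<^sup>2 = a\<^sup>2 + b\<^sup>2" for k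
    using h[of k] by (auto simp: doubleton_eq_iff)
  note disp = top_bar_displacement[OF \<delta> hpos hpos arm arm top]
  have dec: "decseq x"
    using disp(2) by (simp add: decseq_Suc_iff)
  have bound: "\<bar>x k\<bar> \<le> a + b" for k
  proof -
    have "(x k)\<^sup>2 \<le> (h k)\<^sup>2"
      by (metis arm le_add_same_cancel1 zero_le_power2)
    then have "\<bar>x k\<bar> \<le> h k"
      using hpos[of k] by (simp add: abs_le_square_iff[symmetric])
    also have "h k \<le> a + b"
      using h[of k] ab by (auto simp: doubleton_eq_iff)
    finally show ?thesis .
  qed
  then have "-(a + b) \<le> x k" for k
    by (metis abs_le_iff minus_le_iff)
  then obtain X where X: "x \<longlonglongrightarrow> X"
    using decseq_convergent[OF dec] by blast
  have X': "(\<lambda>k. x (Suc k)) \<longlonglongrightarrow> X"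
    using X by (simp add: LIMSEQ_Suc)
  \<comment> \<open>The individual \<open>h k\<close> do not converge; they only occur with a null factor here.\<close>
  have "(\<lambda>k. (h (Suc k))\<^sup>2 * ((x k)\<^sup>2 - (x (Suc k))\<^sup>2)) \<longlonglongrightarrow> 0"
  proof (rule Lim_null_comparison)
    have "norm ((h (Suc k))\<^sup>2 * ((x k)\<^sup>2 - (x (Suc k))\<^sup>2)) \<le>
        (a\<^sup>2 + b\<^sup>2) * \<bar>(x k)\<^sup>2 - (x (Suc k))\<^sup>2\<bar>" for k
      unfolding sum[of k, symmetric] by (simp add: abs_mult mult_right_mono)
    then show "\<forall>\<^sub>F k in sequentially. norm ((h (Suc k))\<^sup>2 * ((x k)\<^sup>2 - (x (Suc k))\<^sup>2)) \<le>
        (a\<^sup>2 + b\<^sup>2) * \<bar>(x k)\<^sup>2 - (x (Suc k))\<^sup>2\<bar>"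
      by simp
    have "(\<lambda>k. (a\<^sup>2 + b\<^sup>2) * \<bar>(x k)\<^sup>2 - (x (Suc k))\<^sup>2\<bar>) \<longlonglongrightarrow> (a\<^sup>2 + b\<^sup>2) * \<bar>X\<^sup>2 - X\<^sup>2\<bar>"
      by (intro tendsto_intros X X')
    then show "(\<lambda>k. (a\<^sup>2 + b\<^sup>2) * \<bar>(x k)\<^sup>2 - (x (Suc k))\<^sup>2\<bar>) \<longlonglongrightarrow> 0"
      by simp
  qed
  then have lim1: "(\<lambda>k. (a\<^sup>2 + b\<^sup>2) * (x (Suc k))\<^sup>2 + (h (Suc k))\<^sup>2 * ((x k)\<^sup>2 - (x (Suc k))\<^sup>2))
      \<longlonglongrightarrow> (a\<^sup>2 + b\<^sup>2) * X\<^sup>2 + 0"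
    by (intro tendsto_intros X')
  have eq: "(a\<^sup>2 + b\<^sup>2) * (x (Suc k))\<^sup>2 + (h (Suc k))\<^sup>2 * ((x k)\<^sup>2 - (x (Suc k))\<^sup>2) =
      (a * b)\<^sup>2 + (x k * x (Suc k))\<^sup>2 - (a * b - x k * x (Suc k) - \<delta> * (x k - x (Suc k)))\<^sup>2" for k
  proof -
    have y: "(y k)\<^sup>2 = (h k)\<^sup>2 - (x k)\<^sup>2" "(y (Suc k))\<^sup>2 = (h (Suc k))\<^sup>2 - (x (Suc k))\<^sup>2"
      using arm[of k] arm[of "Suc k"] by linarith+
    have "(a * b - x k * x (Suc k) - \<delta> * (x k - x (Suc k)))\<^sup>2 = (y k)\<^sup>2 * (y (Suc k))\<^sup>2"
      using disp(1)[of k] prod[of k] by (metis power_mult_distrib)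
    then show ?thesis
      unfolding y sum[of k, symmetric] prod[of k, symmetric]
      by (simp add: power2_eq_square algebra_simps)
  qed
  have "(\<lambda>k. (a * b)\<^sup>2 + (x k * x (Suc k))\<^sup>2 - (a * b - x k * x (Suc k) - \<delta> * (x k - x (Suc k)))\<^sup>2)
      \<longlonglongrightarrow> (a * b)\<^sup>2 + (X * X)\<^sup>2 - (a * b - X * X - \<delta> * (X - X))\<^sup>2"
    by (intro tendsto_intros X X')
  from LIMSEQ_unique[OF lim1[unfolded eq] this]
  have "((a - b) * X)\<^sup>2 = 0"
    by (simp add: power2_eq_square algebra_simps)
  then have "X = 0"
    using ab(3) by simp
  then show ?thesis
    using decseq_ge[OF dec X, of 0] by simp
qed

text \<open>
  The mirror image \<open>n \<mapsto> -n\<close>, \<open>x \<mapsto> -x\<close> of a strip is again a strip with the same heights, so the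
  bound for half strips applies in both directions.
\<close>

lemma strip_displacement_zero:
  fixes x y h :: "int \<Rightarrow> real"
  assumes \<delta>: "\<delta> > 0" and ab: "a > 0" "b > 0" "a \<noteq> b" and h: "\<And>n. h n = (if even n then a else b)"
    and arm: "\<And>n. (x n)\<^sup>2 + (y n)\<^sup>2 = (h n)\<^sup>2"
    and top: "\<And>n. (\<delta> + x (n + 1) - x n)\<^sup>2 + (y (n + 1) - y n)\<^sup>2 = \<delta>\<^sup>2 + (h (n + 1) - h n)\<^sup>2"
  shows "x n = 0"
proof -
  have "x (n + int 0) \<ge> 0"
  proof (rule half_strip_displacement_nonneg[OF \<delta> ab,
        where x = "\<lambda>k. x (n + int k)" and y = "\<lambda>k. y (n + int k)" and h = "\<lambda>k. h (n + int k)"])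
    show "{h (n + int k), h (n + int (Suc k))} = {a, b}" for k
      by (auto simp: h)
    show "(\<delta> + x (n + int (Suc k)) - x (n + int k))\<^sup>2 + (y (n + int (Suc k)) - y (n + int k))\<^sup>2 =
        \<delta>\<^sup>2 + (h (n + int (Suc k)) - h (n + int k))\<^sup>2" for k
      using top[of "n + int k"] by (simp add: algebra_simps)
  qed (rule arm)
  moreover have "- x (n - int 0) \<ge> 0"
  proof (rule half_strip_displacement_nonneg[OF \<delta> ab,
        where x = "\<lambda>k. - x (n - int k)" and y = "\<lambda>k. y (n - int k)" and h = "\<lambda>k. h (n - int k)"])
    show "{h (n - int k), h (n - int (Suc k))} = {a, b}" for k
      by (auto simp: h)
    show "(\<delta> + - x (n - int (Suc k)) - - x (n - int k))\<^sup>2 + (y (n - int (Suc k)) - y (n - int k))\<^sup>2 =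
        \<delta>\<^sup>2 + (h (n - int (Suc k)) - h (n - int k))\<^sup>2" for k
    proof -
      have "n - int (Suc k) + 1 = n - int k"
        by simp
      moreover have "\<delta> + - x (n - int (Suc k)) - - x (n - int k) =
          \<delta> + x (n - int k) - x (n - int (Suc k))"
        by simp
      ultimately show ?thesis
        using top[of "n - int (Suc k)"] by (simp only: power2_commute)
    qed
    show "(- x (n - int k))\<^sup>2 + (y (n - int k))\<^sup>2 = (h (n - int k))\<^sup>2" for k
      by (simp add: arm)
  qed
  ultimately show ?thesis
    by simp
qed

section \<open>Rigidity of trapezium strips\<close>

lemma strip_is_framework:
  assumes "\<delta> > 0" "girder \<delta> G \<beta>" "\<And>n. h n > 0"
  shows "is_framework (strip \<delta> G \<beta> h)"
  unfolding is_framework_def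
proof
  fix e assume "e \<in> bars (strip \<delta> G \<beta> h)"
  then have "e \<in> (\<lambda>e. Girder ` e) ` bars G \<or>
      (\<exists>n. e = {Girder (\<beta> n), Top n}) \<or> (\<exists>n. e = {Top n, Top (n + 1)})"
    unfolding strip_def by simp
  then consider e' where "e' \<in> bars G" "e = Girder ` e'"
    | n where "e = {Girder (\<beta> n), Top n}" | n where "e = {Top n, Top (n + 1)}"
    by (elim disjE exE imageE)
  then show "\<exists>u v. e = {u, v} \<and> u \<in> verts (strip \<delta> G \<beta> h) \<and> v \<in> verts (strip \<delta> G \<beta> h) \<and>
      u \<noteq> v \<and> pos (strip \<delta> G \<beta> h) u \<noteq> pos (strip \<delta> G \<beta> h) v"
  proof cases
    case 1
    then obtain u v where "e' = {u, v}" "u \<in> verts G" "v \<in> verts G" "u \<noteq> v" "pos G u \<noteq> pos G v"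
      using assms(2) unfolding girder_def is_framework_def by blast
    with 1 show ?thesis
      by (intro exI[of _ "Girder u"] exI[of _ "Girder v"]) (auto simp: strip_def)
  next
    case 2
    have "\<beta> n \<in> verts G" "pos G (\<beta> n) = vector [real_of_int n * \<delta>, 0]"
      using assms(2) unfolding girder_def by blast+
    with 2 assms(3)[of n] show ?thesis
      by (intro exI[of _ "Girder (\<beta> n)"] exI[of _ "Top n"])
        (auto simp: strip_def vec_eq_iff forall_2)
  next
    case 3
    with assms(1) show ?thesis
      by (intro exI[of _ "Top n"] exI[of _ "Top (n + 1)"])
        (auto simp: strip_def vec_eq_iff forall_2)
  qed
qed

lemma dist_plane_square: "(dist (x :: real ^ 2) y)\<^sup>2 = (x $ 1 - y $ 1)\<^sup>2 + (x $ 2 - y $ 2)\<^sup>2"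
  by (simp add: dist_vec_def L2_set_def UNIV_2 dist_real_def)

lemma continuous_sign_constant:
  fixes f :: "real \<Rightarrow> real"
  assumes "continuous_on {0..1} f" "\<And>t. t \<in> {0..1} \<Longrightarrow> (f t)\<^sup>2 = c\<^sup>2" "f 0 = c" "c > 0" "t \<in> {0..1}"
  shows "f t = c"
proof (rule ccontr)
  assume "f t \<noteq> c"
  with assms(2)[OF assms(5)] have "f t = - c"
    by (simp add: power2_eq_iff)
  then obtain s where "0 \<le> s" "s \<le> t" "f s = 0"
    using IVT2'[of f t 0 0] continuous_on_subset[OF assms(1), of "{0..t}"] assms(3-5) by auto
  with assms(2)[of s] assms(4,5) show False
    by simp
qed

text \<open>
  The girder is at rest, so at each single time the displacements of the top points
  vanish. This leaves only the heights \<open>\<plusminus>h\<^sub>n\<close>, and continuity in time excludes the minus sign.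
\<close>

lemma trapezium_strip_pinned_motion_trivial:
  assumes \<delta>: "\<delta> > 0" and G: "girder \<delta> G \<beta>" and ab: "a > 0" "b > 0" "a \<noteq> b"
    and F: "F = trapezium_strip \<delta> G \<beta> a b" and r: "motion F r" and bar: "{u0, v0} \<in> bars G"
    and pin: "\<And>t. t \<in> {0..1} \<Longrightarrow>
      r t (Girder u0) = pos F (Girder u0) \<and> r t (Girder v0) = pos F (Girder v0)"
    and t: "t \<in> {0..1}" and v: "v \<in> verts F"
  shows "r t v = pos F v"
proof -
  define h where "h n = (if even n then a else b)" for n :: int
  have F': "F = strip \<delta> G \<beta> h"
    by (simp add: F trapezium_strip_def h_def[abs_def])
  have hpos: "h n > 0" for n
    using ab by (simp add: h_def)
  have posG: "pos F (Girder g) = pos G g" for g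
    by (simp add: F' strip_def)
  have posT: "pos F (Top n) = vector [real_of_int n * \<delta>, h n]" for n
    by (simp add: F' strip_def)
  have base: "\<beta> n \<in> verts G" "pos G (\<beta> n) = vector [real_of_int n * \<delta>, 0]" for n
    using G unfolding girder_def by blast+
  have vertsG: "Girder g \<in> verts F" if "g \<in> verts G" for g
    using that by (simp add: F' strip_def)
  have vertsT: "Top n \<in> verts F" for n
    by (simp add: F' strip_def)
  have barG: "{Girder u, Girder v} \<in> bars F" if "{u, v} \<in> bars G" for u v
    using imageI[OF that, of "(`) Girder"] by (simp add: F' strip_def)
  have barA: "{Girder (\<beta> n), Top n} \<in> bars F" and barT: "{Top n, Top (n + 1)} \<in> bars F" for n
    by (auto simp: F' strip_def)
  have len: "dist (r s u) (r s v) = dist (pos F u) (pos F v)"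
    if "{u, v} \<in> bars F" "s \<in> {0..1}" for u v s
    using r that unfolding motion_def by blast
  have "motion G (\<lambda>s g. r s (Girder g))"
    using r vertsG barG unfolding motion_def by (simp add: posG)
  then have girder: "r s (Girder g) = pos G g" if "s \<in> {0..1}" "g \<in> verts G" for s g
    using G bar pin that unfolding girder_def
    by (intro girder_pinned_motion_trivial[where r = "\<lambda>s g. r s (Girder g)"]) (simp_all add: posG)
  have x: "r s (Top n) $ 1 = real_of_int n * \<delta>" and y: "(r s (Top n) $ 2)\<^sup>2 = (h n)\<^sup>2"
    if s: "s \<in> {0..1}" for s n
  proof -
    define x where "x m = r s (Top m) $ 1 - real_of_int m * \<delta>" for m
    define y where "y m = r s (Top m) $ 2" for m
    have arm: "(x m)\<^sup>2 + (y m)\<^sup>2 = (h m)\<^sup>2" for m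
    proof -
      have "(dist (r s (Girder (\<beta> m))) (r s (Top m)))\<^sup>2 =
          (dist (pos F (Girder (\<beta> m))) (pos F (Top m)))\<^sup>2"
        using len[OF barA s] by simp
      then show ?thesis
        by (simp add: girder[OF s base(1)] posG posT base(2) dist_plane_square x_def y_def
            power2_commute)
    qed
    have "(\<delta> + x (m + 1) - x m)\<^sup>2 + (y (m + 1) - y m)\<^sup>2 = \<delta>\<^sup>2 + (h (m + 1) - h m)\<^sup>2" for m
    proof -
      have "(dist (r s (Top (m + 1))) (r s (Top m)))\<^sup>2 =
          (dist (pos F (Top (m + 1))) (pos F (Top m)))\<^sup>2"
        using len[OF barT s] by (simp add: dist_commute)
      moreover have "real_of_int (m + 1) * \<delta> - real_of_int m * \<delta> = \<delta>"
        by (simp add: algebra_simps)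
      moreover have "\<delta> + x (m + 1) - x m = r s (Top (m + 1)) $ 1 - r s (Top m) $ 1"
        by (simp add: x_def algebra_simps)
      ultimately show ?thesis
        by (simp add: posT dist_plane_square y_def del: of_int_add)
    qed
    from strip_displacement_zero[OF \<delta> ab h_def arm this] have "x n = 0" .
    with arm[of n] show "r s (Top n) $ 1 = real_of_int n * \<delta>" "(r s (Top n) $ 2)\<^sup>2 = (h n)\<^sup>2"
      by (simp_all add: x_def y_def)
  qed
  show ?thesis
  proof (cases v)
    case (Girder g)
    with v have "g \<in> verts G"
      by (auto simp: F' strip_def)
    with Girder girder[OF t] show ?thesis
      by (simp add: posG)
  next
    case (Top n)
    have "r t (Top n) $ 2 = h n"
    proof (rule continuous_sign_constant[where f = "\<lambda>s. r s (Top n) $ 2"])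
      show "continuous_on {0..1} (\<lambda>s. r s (Top n) $ 2)"
        using r vertsT unfolding motion_def by (intro continuous_intros) blast
      have "r 0 (Top n) = pos F (Top n)"
        using r vertsT unfolding motion_def by blast
      then show "r 0 (Top n) $ 2 = h n"
        by (simp add: posT)
    qed (use y hpos t in auto)
    with x[OF t, of n] Top show ?thesis
      by (simp add: posT vec_eq_iff forall_2)
  qed
qed

lemma trapezium_strip_rigid:
  assumes \<delta>: "\<delta> > 0" and G: "girder \<delta> G \<beta>" and ab: "a > 0" "b > 0" "a \<noteq> b"
  shows "rigid (trapezium_strip \<delta> G \<beta> a b)"
proof -
  have "is_framework G" "bars G \<noteq> {}"
    using G by (auto simp: girder_def)
  then obtain e u0 v0 where "e \<in> bars G" "e = {u0, v0}"
    unfolding is_framework_def by (meson ex_in_conv)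
  then have bar: "{u0, v0} \<in> bars G"
    by simp
  have "{Girder u0, Girder v0} \<in> bars (trapezium_strip \<delta> G \<beta> a b)"
    using imageI[OF bar, of "(`) Girder"] by (simp add: trapezium_strip_def strip_def)
  moreover have "is_framework (trapezium_strip \<delta> G \<beta> a b)"
    unfolding trapezium_strip_def using \<delta> G ab by (intro strip_is_framework) auto
  ultimately show ?thesis
    using trapezium_strip_pinned_motion_trivial[OF \<delta> G ab refl _ bar]
    by (intro rigid_if_pinned_motions_trivial) blast+
qed

lemma trapezium_perturbs_rectangle:
  assumes "\<delta> > 0" "girder \<delta> G \<beta>" "h > 0" "\<epsilon> > 0"
  shows "perturbation \<epsilon> (rectangle_strip \<delta> G \<beta> h) (trapezium_strip \<delta> G \<beta> (h + \<epsilon> / 2) h)"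
proof -
  have "is_framework (trapezium_strip \<delta> G \<beta> (h + \<epsilon> / 2) h)"
    unfolding trapezium_strip_def using assms by (intro strip_is_framework) auto
  with assms(4) show ?thesis
    unfolding perturbation_def
    by (auto simp: rectangle_strip_def trapezium_strip_def strip_def dist_vector_2
        split: strip_joint.splits)
qed

theorem proposition2p14:
  fixes \<delta> :: real and G :: "'g framework" and \<beta> :: "int \<Rightarrow> 'g"
  assumes "\<delta> > 0" and "girder \<delta> G \<beta>"
  shows "(\<forall>a b. a > b \<and> b > 0 \<longrightarrow> rigid (trapezium_strip \<delta> G \<beta> a b)) \<and>
         (\<forall>h > 0. \<not> stably_flexible (rectangle_strip \<delta> G \<beta> h))"
proof (intro conjI allI impI notI)
  fix a b :: real assume "a > b \<and> b > 0"
  then show "rigid (trapezium_strip \<delta> G \<beta> a b)"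
    using assms by (intro trapezium_strip_rigid) auto
next
  fix h :: real assume h: "h > 0" and "stably_flexible (rectangle_strip \<delta> G \<beta> h)"
  then obtain \<epsilon>\<^sub>0 where "\<epsilon>\<^sub>0 > 0" and stable: "\<And>\<epsilon> F'. 0 < \<epsilon> \<Longrightarrow> \<epsilon> < \<epsilon>\<^sub>0 \<Longrightarrow>
      perturbation \<epsilon> (rectangle_strip \<delta> G \<beta> h) F' \<Longrightarrow> flexible F'"
    unfolding stably_flexible_def by blast
  then obtain \<epsilon> where \<epsilon>: "0 < \<epsilon>" "\<epsilon> < \<epsilon>\<^sub>0"
    using dense by blast
  then have "flexible (trapezium_strip \<delta> G \<beta> (h + \<epsilon> / 2) h)"
    using stable trapezium_perturbs_rectangle[OF assms h] by blast
  moreover have "rigid (trapezium_strip \<delta> G \<beta> (h + \<epsilon> / 2) h)"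
    using trapezium_strip_rigid[OF assms] h \<epsilon> by simp
  ultimately show False
    by (simp add: rigid_def)
qed

end
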